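(* Let $n \geq 12$ be an even integer. Let $G_n$ be the graph with vertices $v_1,\ldots,v_n$ and the following edges: (1) the edges of the cycle $v_1v_2\cdots v_nv_1$, i.e. $v_iv_{i+1}$ for $1\le i\le n-1$ and $v_nv_1$; (2) $v_n v_{\frac n2-1}$; (3) $v_1v_{n-2}$; (4) $v_{n-1}v_{n-3}$; (5) $v_kv_{n-2-k}$ for every integer $k$ with $2\le k\le \frac n2-2$. Then $G_n$ is a cubic (3-regular) Hamiltonian graph, and $G_n$ is asymmetric.
   Context: Graphs are undirected, without loops or multiple edges. A graph is asymmetric if its automorphism group (acting on vertices) is trivial. *)

theory Defs
  imports "Graph_Theory.Graph_Theory" "HOL-Combinatorics.Permutations"
begin

text \<open>
  Finite simple undirected graphs are the members of the locale \<^locale>\<open>pair_graph\<close>: finite,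
  loop-free, symmetric digraphs whose arcs are pairs of vertices. An undirected edge is
  represented by its two opposite arcs, so the degree of a vertex is its out-degree.
\<close>

definition regular_graph :: "nat \<Rightarrow> 'a pair_pre_digraph \<Rightarrow> bool" where
  "regular_graph d G \<longleftrightarrow> pair_graph G \<and> (\<forall>v \<in> pverts G. out_degree (with_proj G) v = d)"

abbreviation cubic_graph :: "'a pair_pre_digraph \<Rightarrow> bool" where
  "cubic_graph G \<equiv> regular_graph 3 G"

text \<open>
  The bound on the length excludes the closed walk along a single edge and back, which is a
  cycle of the symmetric digraph but not of the undirected graph.
\<close>

definition hamiltonian_graph :: "'a pair_pre_digraph \<Rightarrow> bool" where
  "hamiltonian_graph G \<longleftrightarrow> pair_graph G \<and>
     (\<exists>p. pre_digraph.cycle (with_proj G) p \<and> 3 \<le> length p \<and> fst ` set p = pverts G)"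

text \<open>
  A permutation in the sense of \<^const>\<open>permutes\<close> is the identity outside the vertex set, so every
  permutation of the vertices corresponds to exactly one function.
\<close>

definition graph_automorphisms :: "'a pair_pre_digraph \<Rightarrow> ('a \<Rightarrow> 'a) set" where
  "graph_automorphisms G = {f. f permutes pverts G \<and>
     (\<forall>u \<in> pverts G. \<forall>v \<in> pverts G. (f u, f v) \<in> parcs G \<longleftrightarrow> (u, v) \<in> parcs G)}"

definition asymmetric_graph :: "'a pair_pre_digraph \<Rightarrow> bool" where
  "asymmetric_graph G \<longleftrightarrow> pair_graph G \<and> graph_automorphisms G = {id}"

text \<open>
  The vertex \<open>v\<^sub>i\<close> is the number \<open>i\<close>, and each edge is listed in one of its two orientations.
  The definition is meant for even \<open>n \<ge> 12\<close>, where \<open>n div 2\<close> is exact and no subtraction truncates.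
\<close>

definition G_edges :: "nat \<Rightarrow> nat rel" where
  "G_edges n =
     {(i, i + 1) | i. 1 \<le> i \<and> i \<le> n - 1} \<union> {(n, 1)} \<union>
     {(n, n div 2 - 1)} \<union>
     {(1, n - 2)} \<union>
     {(n - 1, n - 3)} \<union>
     {(k, n - 2 - k) | k. 2 \<le> k \<and> k \<le> n div 2 - 2}"

definition G_graph :: "nat \<Rightarrow> nat pair_pre_digraph" where
  "G_graph n = \<lparr> pverts = {1..n}, parcs = G_edges n \<union> (G_edges n)\<inverse> \<rparr>"

end

(*
  Write n = 2m. Apart from the vertices n - 3, ..., n and 1, the graph is a ladder folded at
  m - 1, with rungs joining k and n - 2 - k. Its only triangles are {m - 2, m - 1, m} and
  {n - 3, n - 2, n - 1}, and n is the only vertex outside them with two neighbours in them. So an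
  automorphism fixes n, then 1 (the only neighbour of n outside the triangles), then n - 2 (the
  only neighbour of 1 in a triangle) and n - 1 (besides 1 the only common neighbour of n and
  n - 2). In a cubic graph, a fixed vertex with two fixed neighbours has its third neighbour fixed
  as well, and this propagates along the ladder.
*)

theory Submission
  imports Defs
begin

section \<open>Explicit neighbourhoods\<close>

text \<open>The edge at \<open>v\<close> that is not on the Hamiltonian cycle. The last branch is
  the rung reflection, which would send \<open>m - 1\<close> to itself; this vertex is paired with
  \<open>2*m\<close> instead, and the ends of the ladder are paired among themselves.\<close>

definition chord :: "nat \<Rightarrow> nat \<Rightarrow> nat" where
  "chord m v = (if v = 2*m then m - 1 else if v = m - 1 then 2*m
     else if v = 1 then 2*m - 2 else if v = 2*m - 2 then 1
     else if v = 2*m - 1 then 2*m - 3 else if v = 2*m - 3 then 2*m - 1 else 2*m - 2 - v)"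

definition neighbours :: "nat \<Rightarrow> nat \<Rightarrow> nat set" where
  "neighbours m v =
     {if v = 2*m then 1 else v + 1, if v = 1 then 2*m else v - 1, chord m v}"

text \<open>Isolates the generic ladder vertex \<open>v\<close> with its rung partner
  \<open>c\<close>. The equation \<open>v + c + 2 = 2*m\<close> is symmetric in the two ends and
  avoids truncated subtraction; \<open>v \<noteq> c\<close> excludes the fold
  \<open>m - 1\<close>.\<close>

lemma vertex_cases:
  fixes m v :: nat
  assumes "6 \<le> m" "v \<in> {1..2*m}"
  obtains "v = 1" | "v = 2*m" | "v = 2*m - 1" | "v = 2*m - 2" | "v = 2*m - 3" | "v = m - 1"
  | c where "v + c + 2 = 2*m" "2 \<le> v" "2 \<le> c" "v \<noteq> c"
proof (cases "v = 1 \<or> v = m - 1 \<or> 2*m - 3 \<le> v")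
  case True
  then have "v = 1 \<or> v = 2*m \<or> v = 2*m - 1 \<or> v = 2*m - 2 \<or> v = 2*m - 3 \<or> v = m - 1"
    using assms by auto
  then show thesis using that by blast
next
  case False
  then have "v + (2*m - 2 - v) + 2 = 2*m" "2 \<le> v" "2 \<le> 2*m - 2 - v" "v \<noteq> 2*m - 2 - v"
    using assms by auto
  then show thesis using that by blast
qed

lemma chord_special:
  assumes "6 \<le> m"
  shows "chord m 1 = 2*m - 2" "chord m (2*m) = m - 1" "chord m (2*m - 1) = 2*m - 3"
    "chord m (2*m - 2) = 1" "chord m (2*m - 3) = 2*m - 1" "chord m (m - 1) = 2*m"
proof -
  \<comment> \<open>With \<open>m\<close> replaced by \<open>j + 6\<close>, simplification can
    evaluate the subtractions and decide which branch of \<open>chord\<close> applies.\<close>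
  obtain j where "m = j + 6"
    using assms by (metis le_add_diff_inverse2)
  then show "chord m 1 = 2*m - 2" "chord m (2*m) = m - 1" "chord m (2*m - 1) = 2*m - 3"
    "chord m (2*m - 2) = 1" "chord m (2*m - 3) = 2*m - 1" "chord m (m - 1) = 2*m"
    by (simp_all add: chord_def)
qed

lemma neighbours_special:
  assumes "6 \<le> m"
  shows "neighbours m 1 = {2, 2*m, 2*m - 2}"
    and "neighbours m (2*m) = {1, 2*m - 1, m - 1}"
    and "neighbours m (2*m - 1) = {2*m, 2*m - 2, 2*m - 3}"
    and "neighbours m (2*m - 2) = {2*m - 1, 2*m - 3, 1}"
    and "neighbours m (2*m - 3) = {2*m - 2, 2*m - 4, 2*m - 1}"
    and "neighbours m (m - 1) = {m, m - 2, 2*m}"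
proof -
  obtain j where "m = j + 6"
    using assms by (metis le_add_diff_inverse2)
  then show "neighbours m 1 = {2, 2*m, 2*m - 2}"
    and "neighbours m (2*m) = {1, 2*m - 1, m - 1}"
    and "neighbours m (2*m - 1) = {2*m, 2*m - 2, 2*m - 3}"
    and "neighbours m (2*m - 2) = {2*m - 1, 2*m - 3, 1}"
    and "neighbours m (2*m - 3) = {2*m - 2, 2*m - 4, 2*m - 1}"
    and "neighbours m (m - 1) = {m, m - 2, 2*m}"
    by (simp_all add: neighbours_def chord_def add.commute flip: numeral_2_eq_2)
qed

text \<open>The hypotheses rule out every exceptional vertex, so \<open>chord\<close> reaches its
  last branch.\<close>

lemma neighbours_ladder:
  assumes "v + c + 2 = 2*m" "2 \<le> v" "2 \<le> c" "v \<noteq> c"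
  shows "neighbours m v = {v - 1, v + 1, c}"
proof -
  have "v \<noteq> 1" "v \<noteq> 2*m" "v \<noteq> 2*m - 1" "v \<noteq> 2*m - 2" "v \<noteq> 2*m - 3" "v \<noteq> m - 1"
    and "c = 2*m - 2 - v"
    using assms by linarith+
  then show ?thesis
    by (auto simp: neighbours_def chord_def)
qed

lemma neighbours_subset:
  assumes "6 \<le> m" "v \<in> {1..2*m}"
  shows "neighbours m v \<subseteq> {1..2*m}"
proof (cases rule: vertex_cases[OF assms])
  case (7 c)
  then show ?thesis
    unfolding neighbours_ladder[OF 7] by auto
qed (simp_all only: neighbours_special[OF assms(1)], (use assms in auto))

lemma not_in_neighbours_self:
  assumes "6 \<le> m" "v \<in> {1..2*m}"
  shows "v \<notin> neighbours m v"
proof (cases rule: vertex_cases[OF assms])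
  case (7 c)
  then show ?thesis
    unfolding neighbours_ladder[OF 7] by auto
qed (simp_all only: neighbours_special[OF assms(1)], (use assms in auto))

lemma card_neighbours:
  assumes "6 \<le> m" "v \<in> {1..2*m}"
  shows "card (neighbours m v) = 3"
proof -
  have three: "card {a, b, c :: nat} = 3" if "a \<noteq> b" "a \<noteq> c" "b \<noteq> c" for a b c
    using that by simp
  show ?thesis
  proof (cases rule: vertex_cases[OF assms])
    case (7 c)
    show ?thesis
      unfolding neighbours_ladder[OF 7] by (rule three) (use 7 in presburger)+
  qed (simp_all only: neighbours_special[OF assms(1)], (rule three; use assms in linarith)+)
qed

text \<open>Adjacency is recorded in both directions because \<open>G_graph\<close> adjoins the
  converse of \<open>G_edges\<close>.\<close>

lemma G_edges_neighbours:
  assumes "6 \<le> m" "(u, v) \<in> G_edges (2*m)"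
  shows "u \<in> {1..2*m} \<and> v \<in> neighbours m u \<and> v \<in> {1..2*m} \<and> u \<in> neighbours m v"
proof -
  consider "1 \<le> u" "u \<le> 2*m - 1" "v = u + 1" | "u = 2*m" "v = 1" | "u = 2*m" "v = m - 1"
    | "u = 1" "v = 2*m - 2" | "u = 2*m - 1" "v = 2*m - 3"
    | "2 \<le> u" "u \<le> m - 2" "v = 2*m - 2 - u"
    using assms(2) by (auto simp: G_edges_def)
  then show ?thesis
  proof cases
    case 1
    then show ?thesis by (auto simp: neighbours_def)
  next
    case 6
    then have "u + v + 2 = 2*m" "2 \<le> u" "2 \<le> v" "u \<noteq> v" "v + u + 2 = 2*m" "v \<noteq> u"
      using assms(1) by linarith+
    then show ?thesis
      using neighbours_ladder[of u v m] neighbours_ladder[of v u m] by auto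
  qed (simp_all only: neighbours_special[OF assms(1)], (use assms(1) in auto))
qed

lemma neighbours_G_edges:
  assumes "6 \<le> m" "u \<in> {1..2*m}" "v \<in> neighbours m u"
  shows "(u, v) \<in> G_edges (2*m) \<or> (v, u) \<in> G_edges (2*m)"
proof -
  have path: "(i, i + 1) \<in> G_edges (2*m)" if "1 \<le> i" "i \<le> 2*m - 1" for i
    using that by (auto simp: G_edges_def)
  have others: "(2*m, 1) \<in> G_edges (2*m)" "(2*m, m - 1) \<in> G_edges (2*m)"
    "(1, 2*m - 2) \<in> G_edges (2*m)" "(2*m - 1, 2*m - 3) \<in> G_edges (2*m)"
    by (auto simp: G_edges_def)
  \<comment> \<open>\<open>G_edges\<close> lists a rung only from its smaller end;
    \<open>a < b\<close> with sum \<open>2*m - 2\<close> gives the bound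
    \<open>a \<le> m - 2\<close>.\<close>
  have rung: "(a, b) \<in> G_edges (2*m)" if "2 \<le> a" "a < b" "a + b + 2 = 2*m" for a b
  proof -
    have "a \<le> m - 2" "b = 2*m - 2 - a" using that by linarith+
    with that show ?thesis by (auto simp: G_edges_def)
  qed
  have chord: "(u, chord m u) \<in> G_edges (2*m) \<or> (chord m u, u) \<in> G_edges (2*m)"
  proof (cases rule: vertex_cases[OF assms(1,2)])
    case (7 c)
    then have "chord m u = c"
      using assms(1) by (auto simp: chord_def)
    with 7 rung[of u c] rung[of c u] show ?thesis by (cases "u < c") auto
  qed (simp_all only: chord_special[OF assms(1)] others simp_thms)
  have succ: "(u, if u = 2*m then 1 else u + 1) \<in> G_edges (2*m)"
    using path[of u] others(1) assms(2) by (cases "u = 2*m") auto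
  have pred: "(if u = 1 then 2*m else u - 1, u) \<in> G_edges (2*m)"
  proof (cases "u = 1")
    case False
    then have "1 \<le> u - 1" "u - 1 \<le> 2*m - 1" and u: "u - 1 + 1 = u"
      using assms(2) by auto
    then have "(u - 1, u) \<in> G_edges (2*m)"
      using path[of "u - 1"] unfolding u by blast
    with False show ?thesis by (simp only: if_False)
  qed (use others(1) in simp)
  from assms(3) succ pred chord show ?thesis
    unfolding neighbours_def by blast
qed

text \<open>From here on adjacency is computed through \<open>neighbours\<close>, and
  \<open>G_edges\<close> is not unfolded again.\<close>

lemma arc_iff_neighbours:
  assumes "6 \<le> m"
  shows "(u, v) \<in> parcs (G_graph (2*m)) \<longleftrightarrow> u \<in> {1..2*m} \<and> v \<in> neighbours m u"
  using G_edges_neighbours[OF assms] neighbours_G_edges[OF assms]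
  by (auto simp: G_graph_def simp del: atLeastAtMost_iff)

section \<open>The two triangles\<close>

text \<open>The union of both triangles is taken because an automorphism might, a priori,
  interchange them.\<close>

definition triangle_vertices :: "nat \<Rightarrow> nat set" where
  "triangle_vertices m = {m - 2, m - 1, m, 2*m - 3, 2*m - 2, 2*m - 1}"

lemma neighbours_near_middle:
  assumes "6 \<le> m"
  shows "neighbours m (m - 2) = {m - 3, m - 1, m}"
    and "neighbours m m = {m - 1, m + 1, m - 2}"
proof -
  have "m - 2 - 1 = m - 3" "m - 2 + 1 = m - 1"
    using assms by linarith+
  then show "neighbours m (m - 2) = {m - 3, m - 1, m}"
    using neighbours_ladder[of "m - 2" m m] assms by simp
  show "neighbours m m = {m - 1, m + 1, m - 2}"
    using neighbours_ladder[of m "m - 2" m] assms by simp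
qed

lemma triangle_verticesD:
  assumes "6 \<le> m" "v \<in> triangle_vertices m"
  shows "\<exists>x \<in> neighbours m v. \<exists>y \<in> neighbours m v. y \<in> neighbours m x"
proof -
  note nb = neighbours_special[OF assms(1)] neighbours_near_middle[OF assms(1)]
  \<comment> \<open>All ordered pairs within each triangle, so that every vertex finds its two
    companions as witnesses.\<close>
  have "m \<in> neighbours m (m - 1)" "m - 2 \<in> neighbours m (m - 1)" "m - 2 \<in> neighbours m m"
    "m - 1 \<in> neighbours m (m - 2)" "m \<in> neighbours m (m - 2)" "m - 1 \<in> neighbours m m"
    "2*m - 1 \<in> neighbours m (2*m - 2)" "2*m - 3 \<in> neighbours m (2*m - 2)"
    "2*m - 3 \<in> neighbours m (2*m - 1)" "2*m - 2 \<in> neighbours m (2*m - 1)"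
    "2*m - 2 \<in> neighbours m (2*m - 3)" "2*m - 1 \<in> neighbours m (2*m - 3)"
    unfolding nb by blast+
  with assms(2) show ?thesis
    unfolding triangle_vertices_def by blast
qed

text \<open>The rungs at \<open>v - 1\<close> and \<open>v + 1\<close> end at \<open>c + 1\<close>
  and \<open>c - 1\<close>. An edge between two neighbours of \<open>v\<close> would therefore force
  \<open>v = c\<close> or a difference of 2 between \<open>v\<close> and \<open>c\<close>, which
  occurs only for the pair \<open>m - 2\<close>, \<open>m\<close> at the fold.\<close>

lemma ladder_not_in_triangle:
  assumes "6 \<le> m" "v \<notin> triangle_vertices m" "v + c + 2 = 2*m" "2 \<le> v" "2 \<le> c" "v \<noteq> c"
    and "x \<in> neighbours m v" "y \<in> neighbours m v"
  shows "y \<notin> neighbours m x"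
proof -
  \<comment> \<open>\<open>c = m\<close> would mean \<open>v = m - 2\<close>, again a triangle
    vertex.\<close>
  have v: "v \<noteq> m" "c \<noteq> m"
    using assms(2,3) by (auto simp: triangle_vertices_def)
  have y: "y = v - 1 \<or> y = v + 1 \<or> y = c" and "x = v - 1 \<or> x = v + 1 \<or> x = c"
    using assms(7,8) unfolding neighbours_ladder[OF assms(3-6)] by auto
  \<comment> \<open>At \<open>v = 2\<close> and \<open>c = 2\<close> the neighbour along the cycle
    is \<open>1\<close> or \<open>2*m - 3\<close>, whose chord is not a rung.\<close>
  then consider "x = v - 1" "v = 2" | "x = v - 1" "v \<noteq> 2" | "x = v + 1" "c = 2"
    | "x = v + 1" "c \<noteq> 2" | "x = c"
    by blast
  then show ?thesis
  proof cases
    case 1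
    then have "x = 1" by simp
    then show ?thesis
      using y 1 assms(1,3) unfolding \<open>x = 1\<close> neighbours_special[OF assms(1)] by auto
  next
    case 2
    have "neighbours m x = {x - 1, x + 1, c + 1}"
      by (rule neighbours_ladder) (use 2 assms(3-6) v in linarith)+
    moreover have "y \<noteq> x - 1" "y \<noteq> x + 1" "y \<noteq> c + 1"
      using y 2 assms(3-6) v by linarith+
    ultimately show ?thesis by simp
  next
    case 3
    then have "x = 2*m - 3" using assms(3) by simp
    then show ?thesis
      using y 3 assms(1,3) unfolding \<open>x = 2*m - 3\<close> neighbours_special[OF assms(1)] by auto
  next
    case 4
    have "neighbours m x = {x - 1, x + 1, c - 1}"
      by (rule neighbours_ladder) (use 4 assms(3-6) v in linarith)+
    moreover have "y \<noteq> x - 1" "y \<noteq> x + 1" "y \<noteq> c - 1"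
      using y 4 assms(3-6) v by linarith+
    ultimately show ?thesis by simp
  next
    case 5
    have "neighbours m x = {x - 1, x + 1, v}"
      by (rule neighbours_ladder) (use 5 assms(3-6) v in linarith)+
    moreover have "y \<noteq> x - 1" "y \<noteq> x + 1" "y \<noteq> v"
      using y 5 assms(3-6) v by linarith+
    ultimately show ?thesis by simp
  qed
qed

text \<open>Describes the set by adjacency alone, which makes it invariant under automorphisms.
  Outside it only \<open>1\<close>, \<open>2*m\<close> and ladder vertices have to be
  examined.\<close>

lemma triangle_vertices_iff:
  assumes "6 \<le> m" "v \<in> {1..2*m}"
  shows "v \<in> triangle_vertices m \<longleftrightarrow>
    (\<exists>x \<in> neighbours m v. \<exists>y \<in> neighbours m v. y \<in> neighbours m x)"
proof (cases "v \<in> triangle_vertices m")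
  case True
  then show ?thesis using triangle_verticesD[OF assms(1)] by blast
next
  case False
  note nb = neighbours_special[OF assms(1)]
  have nb_2: "neighbours m 2 = {1, 3, 2*m - 4}"
    using neighbours_ladder[of 2 "2*m - 4" m] assms(1) by auto
  have "y \<notin> neighbours m x" if x: "x \<in> neighbours m v" and y: "y \<in> neighbours m v" for x y
  proof (cases rule: vertex_cases[OF assms])
    case 1
    then have "x = 2 \<or> x = 2*m \<or> x = 2*m - 2" "y = 2 \<or> y = 2*m \<or> y = 2*m - 2"
      using x y nb(1) by auto
    then show ?thesis using assms(1) by (elim disjE; simp only: nb nb_2; auto)
  next
    case 2
    then have "x = 1 \<or> x = 2*m - 1 \<or> x = m - 1" "y = 1 \<or> y = 2*m - 1 \<or> y = m - 1"
      using x y nb(2) by auto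
    then show ?thesis using assms(1) by (elim disjE; simp only: nb; auto)
  next
    case (7 c)
    then show ?thesis
      using ladder_not_in_triangle[OF assms(1) False] x y by blast
  qed (use False in \<open>auto simp: triangle_vertices_def\<close>)
  with False show ?thesis by blast
qed

section \<open>Simplicity, regularity and the Hamiltonian cycle\<close>

lemma pverts_G_graph [simp]: "pverts (G_graph n) = {1..n}"
  by (simp add: G_graph_def)

lemma pair_graph_G_graph:
  assumes "6 \<le> m"
  shows "pair_graph (G_graph (2*m))"
proof
  note arc = arc_iff_neighbours[OF assms]
  show fst: "fst e \<in> pverts (G_graph (2*m))" if "e \<in> parcs (G_graph (2*m))" for e
    using that by (cases e) (simp add: arc)
  show snd: "snd e \<in> pverts (G_graph (2*m))" if "e \<in> parcs (G_graph (2*m))" for e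
    using that subsetD[OF neighbours_subset[OF assms, of "fst e"], of "snd e"]
    by (cases e) (simp add: arc)
  show "finite (pverts (G_graph (2*m)))"
    by simp
  have "parcs (G_graph (2*m)) \<subseteq> {1..2*m} \<times> {1..2*m}"
    using fst snd by (simp add: subset_iff mem_Times_iff del: split_paired_All)
  then show "finite (parcs (G_graph (2*m)))"
    by (rule finite_subset) simp
  show "symmetric (with_proj (G_graph (2*m)))"
    by (auto simp: symmetric_def sym_def G_graph_def)
  show "fst e \<noteq> snd e" if "e \<in> parcs (G_graph (2*m))" for e
    using that not_in_neighbours_self[OF assms] by (cases e) (auto simp: arc)
qed

lemma cubic_G_graph:
  assumes "6 \<le> m"
  shows "cubic_graph (G_graph (2*m))"
proof -
  have "out_degree (with_proj (G_graph (2*m))) v = 3" if "v \<in> {1..2*m}" for v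
  proof -
    have "out_arcs (with_proj (G_graph (2*m))) v = Pair v ` neighbours m v"
      using that by (auto simp: out_arcs_def arc_iff_neighbours[OF assms])
    then show ?thesis
      using card_neighbours[OF assms that]
      by (simp add: out_degree_def card_image inj_on_def)
  qed
  then show ?thesis
    using pair_graph_G_graph[OF assms] by (simp add: regular_graph_def)
qed

text \<open>\<open>inc_induct\<close> descends from \<open>a = b\<close>, prepending one arc at a
  time. The end \<open>c\<close> of the last arc is arbitrary, so that it can return to the
  start.\<close>

lemma pcas_successive_arcs:
  assumes "a \<le> b"
  shows "pcas a (map (\<lambda>i. (i, i + 1)) [a..<b] @ [(b, c)]) c"
  using assms
  by (induction rule: inc_induct) (simp_all add: upt_conv_Cons)

lemma hamiltonian_G_graph:
  assumes "6 \<le> m"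
  shows "hamiltonian_graph (G_graph (2*m))"
proof -
  interpret pair_graph "G_graph (2*m)"
    using assms by (rule pair_graph_G_graph)
  define p where "p = map (\<lambda>i. (i, i + 1)) [1..<2*m] @ [(2*m, 1)]"
  have cas: "cas 1 p 1"
    unfolding p_def cas_with_proj_eq
    by (rule pcas_successive_arcs) (use assms in simp)
  have "set p \<subseteq> parcs (G_graph (2*m))"
    using assms by (auto simp: p_def arc_iff_neighbours neighbours_def)
  with cas assms have "awalk 1 p 1"
    by (simp add: awalk_def)
  \<comment> \<open>The tail drops the first occurrence of the vertex \<open>1\<close>, which recurs
    as the end of the closed walk.\<close>
  moreover have "distinct (tl (awalk_verts 1 p))"
    unfolding awalk_verts_conv'[OF cas]
    by (auto simp: p_def distinct_map inj_on_def)
  ultimately have "cycle p"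
    by (auto simp: cycle_def p_def)
  moreover have "fst ` set p = {1..2*m}"
    using assms by (force simp: p_def image_iff)
  ultimately show ?thesis
    using assms pair_graph_G_graph[OF assms]
    by (auto simp: hamiltonian_graph_def p_def intro!: exI[of _ p])
qed

section \<open>Rigidity under automorphisms\<close>

text \<open>For a ladder vertex outside the triangles, the rung partner also lies outside, and so
  does at least one of \<open>v - 1\<close> and \<open>v + 1\<close>, because the triangles are far
  enough apart. Vertex \<open>1\<close> has only the neighbour \<open>2*m - 2\<close> in a
  triangle.\<close>

lemma unique_vertex_joining_triangles:
  assumes "6 \<le> m" and v: "v \<in> {1..2*m} - triangle_vertices m"
    and xy: "x \<in> neighbours m v \<inter> triangle_vertices m"
      "y \<in> neighbours m v \<inter> triangle_vertices m" "x \<noteq> y"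
  shows "v = 2*m"
proof (rule ccontr)
  assume last: "v \<noteq> 2*m"
  have "v \<noteq> 1"
    using \<open>6 \<le> m\<close> xy by (auto simp: neighbours_special(1)[simplified] triangle_vertices_def)
  with v have "2 \<le> v"
    by auto
  have range: "v < m - 2 \<or> m < v \<and> v < 2*m - 3"
    using \<open>6 \<le> m\<close> v last by (simp add: triangle_vertices_def) presburger
  then have nb: "neighbours m v = {v - 1, v + 1, 2*m - 2 - v}"
    using \<open>6 \<le> m\<close> \<open>2 \<le> v\<close> by (intro neighbours_ladder) linarith+
  have outside: "w \<notin> triangle_vertices m" if "w < m - 2 \<or> m < w \<and> w < 2*m - 3" for w
    using that \<open>6 \<le> m\<close> by (auto simp: triangle_vertices_def)
  have "2*m - 2 - v \<notin> triangle_vertices m"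
    by (rule outside) (use range \<open>6 \<le> m\<close> \<open>2 \<le> v\<close> in linarith)
  moreover have "v + 1 \<notin> triangle_vertices m \<or> v - 1 \<notin> triangle_vertices m"
  \<comment> \<open>Only for \<open>v = m + 1\<close> does \<open>v - 1\<close> lie in a triangle;
    then \<open>v + 1 = m + 2\<close> is still below \<open>2*m - 3\<close> because
    \<open>6 \<le> m\<close>.\<close>
  proof (cases "v = m + 1")
    case True
    with \<open>6 \<le> m\<close> show ?thesis
      by (intro disjI1[OF outside]) linarith
  next
    case False
    with range show ?thesis
      by (intro disjI2[OF outside]) linarith
  qed
  ultimately show False
    using xy nb by auto
qed

lemma automorphism_image_neighbours:
  assumes "6 \<le> m" "f \<in> graph_automorphisms (G_graph (2*m))" "v \<in> {1..2*m}"
  shows "f ` neighbours m v = neighbours m (f v)"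
proof -
  have f: "f permutes {1..2*m}"
    and arcs: "\<And>u w. u \<in> {1..2*m} \<Longrightarrow> w \<in> {1..2*m} \<Longrightarrow>
      f w \<in> neighbours m (f u) \<longleftrightarrow> w \<in> neighbours m u"
    using assms(2) permutes_in_image[of f "{1..2*m}"]
    by (simp_all add: graph_automorphisms_def arc_iff_neighbours[OF assms(1)] del: atLeastAtMost_iff)
  have "f v \<in> {1..2*m}"
    using assms(3) permutes_in_image[OF f] by blast
  \<comment> \<open>Every neighbour of \<open>f v\<close> has a preimage among the vertices, so
    \<open>arcs\<close> also yields the reverse inclusion.\<close>
  then have "neighbours m (f v) \<subseteq> f ` {1..2*m}"
    using neighbours_subset[OF assms(1)] permutes_image[OF f] by simp
  with arcs[OF assms(3)] neighbours_subset[OF assms(1,3)] show ?thesis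
    by blast
qed

text \<open>Automorphisms carry triangles to triangles, which gives one inclusion; an injective
  self-map of a finite set is onto.\<close>

lemma automorphism_image_triangle_vertices:
  assumes "6 \<le> m" "f \<in> graph_automorphisms (G_graph (2*m))"
  shows "f ` triangle_vertices m = triangle_vertices m"
proof (rule endo_inj_surj)
  have f: "f permutes {1..2*m}"
    using assms(2) by (simp add: graph_automorphisms_def)
  show "finite (triangle_vertices m)"
    by (simp add: triangle_vertices_def)
  show "inj_on f (triangle_vertices m)"
    using permutes_inj[OF f] by (rule inj_on_subset) simp
  show "f ` triangle_vertices m \<subseteq> triangle_vertices m"
  proof (rule image_subsetI)
    fix v assume v: "v \<in> triangle_vertices m"
    then have V: "v \<in> {1..2*m}"
      using assms(1) by (auto simp: triangle_vertices_def)
    then have fV: "f v \<in> {1..2*m}"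
      using permutes_in_image[OF f] by blast
    from v obtain x y where xy: "x \<in> neighbours m v" "y \<in> neighbours m v" "y \<in> neighbours m x"
      using triangle_vertices_iff[OF assms(1) V] by blast
    then have "x \<in> {1..2*m}"
      using neighbours_subset[OF assms(1) V] by blast
    with xy V have "f x \<in> neighbours m (f v)" "f y \<in> neighbours m (f v)" "f y \<in> neighbours m (f x)"
      using automorphism_image_neighbours[OF assms] by blast+
    then show "f v \<in> triangle_vertices m"
      using triangle_vertices_iff[OF assms(1) fV] by blast
  qed
qed

lemma automorphism_eq_id:
  assumes m: "6 \<le> m" and aut: "f \<in> graph_automorphisms (G_graph (2*m))"
  shows "f = id"
proof -
  have f: "f permutes {1..2*m}"
    using aut by (simp add: graph_automorphisms_def)
  have inj: "f x = f y \<longleftrightarrow> x = y" for x y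
    using permutes_inj[OF f] by (auto dest: injD)
  have nb: "f x \<in> neighbours m (f v)" if "v \<in> {1..2*m}" "x \<in> neighbours m v" for v x
    using automorphism_image_neighbours[OF m aut that(1)] that(2) by blast
  have tri: "f v \<in> triangle_vertices m \<longleftrightarrow> v \<in> triangle_vertices m" for v
    using automorphism_image_triangle_vertices[OF m aut] permutes_inj[OF f]
    by (metis inj_image_mem_iff)
  \<comment> \<open>\<open>f c\<close> is again a neighbour of \<open>v\<close>, and injectivity
    keeps it away from \<open>a = f a\<close> and \<open>b = f b\<close>. The undetermined neighbour
    is written in the middle; \<open>insert_commute\<close> later brings neighbourhoods into this
    order.\<close>
  have third: "f c = c"
    if "f v = v" "f a = a" "f b = b" "v \<in> {1..2*m}" "neighbours m v = {a, c, b}" "c \<noteq> a" "c \<noteq> b"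
    for v a b c
  proof -
    have "f c \<in> {a, c, b}"
      using nb[of v c] that(4) unfolding that(1,5) by simp
    with that(2,3,6,7) inj show ?thesis
      by (metis empty_iff insert_iff)
  qed

  note nb_1 = neighbours_special(1)[OF m]
  note nb_last = neighbours_special(2)[OF m]
  note nb_n2 = neighbours_special(4)[OF m]
  note nb_n3 = neighbours_special(5)[OF m]

  have T: "2*m \<notin> triangle_vertices m" "1 \<notin> triangle_vertices m" "2 \<notin> triangle_vertices m"
    "m - 1 \<in> triangle_vertices m" "2*m - 1 \<in> triangle_vertices m" "2*m - 2 \<in> triangle_vertices m"
    using m by (simp_all add: triangle_vertices_def) (linarith+)?
  \<comment> \<open>The images of \<open>m - 1\<close> and \<open>2*m - 1\<close> are two distinct
    triangle vertices adjacent to \<open>f (2*m)\<close>.\<close>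
  have f_last: "f (2*m) = 2*m"
  proof (rule unique_vertex_joining_triangles[OF m])
    show "f (2*m) \<in> {1..2*m} - triangle_vertices m"
      using m permutes_in_image[OF f, of "2*m"] T by (simp add: tri)
    show "f (m - 1) \<in> neighbours m (f (2*m)) \<inter> triangle_vertices m"
      "f (2*m - 1) \<in> neighbours m (f (2*m)) \<inter> triangle_vertices m"
      using m nb[of "2*m"] T by (simp_all add: tri nb_last)
    show "f (m - 1) \<noteq> f (2*m - 1)"
      using m by (simp add: inj)
  qed
  have f_1: "f 1 = 1"
  proof -
    have "f 1 \<in> {1, 2*m - 1, m - 1}"
      using nb[of "2*m" 1] m unfolding f_last nb_last by simp
    then show ?thesis
      using tri[of 1] T by auto
  qed
  have f_n2: "f (2*m - 2) = 2*m - 2"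
  proof -
    have "f (2*m - 2) \<in> {2, 2*m, 2*m - 2}"
      using nb[of 1 "2*m - 2"] m unfolding f_1 nb_1 by simp
    then show ?thesis
      using tri[of "2*m - 2"] T by auto
  qed
  have f_n1: "f (2*m - 1) = 2*m - 1"
  proof -
    have "f (2*m - 1) \<in> {1, 2*m - 1, m - 1}"
      using nb[of "2*m" "2*m - 1"] m unfolding f_last nb_last by simp
    moreover have "f (2*m - 1) \<in> {2*m - 1, 2*m - 3, 1}"
      using nb[of "2*m - 2" "2*m - 1"] m unfolding f_n2 nb_n2 by simp
    moreover have "f (2*m - 1) \<noteq> 1"
      using inj[of "2*m - 1" 1] m f_1 by simp
    moreover have "m - 1 \<noteq> 2*m - 1" "m - 1 \<noteq> 2*m - 3"
      using m by linarith+
    ultimately show ?thesis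
      by auto
  qed
  have f_n3: "f (2*m - 3) = 2*m - 3"
    using third[OF f_n2 f_n1 f_1 _ nb_n2] m by auto
  have f_n4: "f (2*m - 4) = 2*m - 4"
    using third[OF f_n3 f_n2 f_n1 _ nb_n3] m by auto
  have f_2: "f 2 = 2"
    using third[OF f_1 f_last f_n2 _ nb_1[unfolded insert_commute[of 2 "2*m"]]] m by auto
  have f_m1: "f (m - 1) = m - 1"
    using third[OF f_last f_1 f_n1 _ nb_last[unfolded insert_commute[of "2*m - 1" "m - 1"]]] m by auto

  \<comment> \<open>The invariant fixes two consecutive vertices on each rail: \<open>k\<close>,
    \<open>k + 1\<close> and, opposite them, \<open>2*m - 2 - k\<close>, \<open>2*m - 3 - k\<close>.
    At \<open>k = m - 2\<close> the rails meet in \<open>m - 1\<close>.\<close>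
  have ladder: "f (k + 1) = k + 1 \<and> f k = k \<and> f (2*m - 2 - k) = 2*m - 2 - k
      \<and> f (2*m - 3 - k) = 2*m - 3 - k" if "1 \<le> k" "k \<le> m - 2" for k
    using that
  proof (induction k rule: nat_induct_at_least)
    case base
    show ?case using f_1 f_2 f_n3 f_n4 by (simp flip: numeral_2_eq_2)
  next
    case (Suc k)
    then have k: "1 \<le> k" "Suc k \<le> m - 2" and IH: "f (k + 1) = k + 1" "f k = k"
        "f (2*m - 2 - k) = 2*m - 2 - k" "f (2*m - 3 - k) = 2*m - 3 - k"
      by auto
    have "neighbours m (k + 1) = {k + 1 - 1, k + 1 + 1, 2*m - 3 - k}"
      by (rule neighbours_ladder) (use m k in linarith)+
    then have "neighbours m (k + 1) = {k, k + 2, 2*m - 3 - k}"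
      by simp
    \<comment> \<open>The rung joining \<open>k + 1\<close> and \<open>2*m - 3 - k\<close> has both
      ends fixed; each end also has a fixed predecessor on its rail, so the next vertex on either
      rail is fixed too.\<close>
    then have up: "f (k + 2) = k + 2"
      using third[OF IH(1,2,4)] k by auto
    have "2*m - 3 - k - 1 = 2*m - 4 - k" "2*m - 3 - k + 1 = 2*m - 2 - k"
      using k by linarith+
    moreover have "neighbours m (2*m - 3 - k) = {2*m - 3 - k - 1, 2*m - 3 - k + 1, k + 1}"
      by (rule neighbours_ladder) (use m k in linarith)+
    ultimately have "neighbours m (2*m - 3 - k) = {2*m - 2 - k, 2*m - 4 - k, k + 1}"
      by (simp only: insert_commute)
    then have down: "f (2*m - 4 - k) = 2*m - 4 - k"
      using third[OF IH(4,3,1)] k by auto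
    have "Suc k + 1 = k + 2" "2*m - 2 - Suc k = 2*m - 3 - k" "2*m - 3 - Suc k = 2*m - 4 - k"
      by auto
    with IH up down show ?case by simp
  qed
  show ?thesis
  proof
    fix v
    \<comment> \<open>\<open>ladder\<close> covers the lower rail directly and the upper rail, from
      \<open>m\<close> to \<open>2*m - 3\<close>, as \<open>2*m - 2 - k\<close>; the last three
      vertices were fixed individually.\<close>
    consider "v \<notin> {1..2*m}" | "1 \<le> v" "v \<le> m - 2" | "v = m - 1"
      | k where "1 \<le> k" "k \<le> m - 2" "v = 2*m - 2 - k" | "2*m - 2 \<le> v" "v \<le> 2*m"
    proof (cases "m \<le> v \<and> v < 2*m - 2")
      case True
      then have "v = 2*m - 2 - (2*m - 2 - v)" "1 \<le> 2*m - 2 - v" "2*m - 2 - v \<le> m - 2"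
        by auto
      then show thesis using that(4) by blast
    next
      case False
      then have "v \<notin> {1..2*m} \<or> 1 \<le> v \<and> v \<le> m - 2 \<or> v = m - 1 \<or> 2*m - 2 \<le> v \<and> v \<le> 2*m"
        using m by (simp; presburger)
      then show thesis using that(1-3,5) by blast
    qed
    then show "f v = id v"
    proof cases
      case 1
      then show ?thesis using permutes_not_in[OF f] by simp
    next
      case 5
      then have "v \<in> {2*m - 2, 2*m - 1, 2*m}" by auto
      then show ?thesis using f_last f_n1 f_n2 by auto
    qed (use ladder f_m1 in auto)
  qed
qed

lemma asymmetric_G_graph:
  assumes "6 \<le> m"
  shows "asymmetric_graph (G_graph (2*m))"
proof -
  have "id \<in> graph_automorphisms (G_graph (2*m))"
    by (simp add: graph_automorphisms_def permutes_id)
  then show ?thesis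
    using automorphism_eq_id[OF assms] pair_graph_G_graph[OF assms]
    by (auto simp: asymmetric_graph_def)
qed

theorem mainTheorem3:
  fixes n :: nat
  assumes "n \<ge> 12" and "even n"
  shows "cubic_graph (G_graph n) \<and> hamiltonian_graph (G_graph n) \<and> asymmetric_graph (G_graph n)"
proof -
  from \<open>even n\<close> obtain m where "n = 2*m" by (rule evenE)
  with \<open>n \<ge> 12\<close> have "6 \<le> m" by simp
  with \<open>n = 2*m\<close> show ?thesis
    using cubic_G_graph hamiltonian_G_graph asymmetric_G_graph by simp
qed

end
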